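(* Let $n\ge1$ be an integer and $\varphi\in\mathcal{LP}_0'$. For any pair $(s,t)\in\mathbb{R}^2$ satisfying $|s|\le|t|$ and $st\ge0$ and for any Schur-convex function $\Phi:\mathbb{R}^n\to\mathbb{R}$ one has $$\Phi\big(x_1(\varphi(sD)[P]),\ldots,x_n(\varphi(sD)[P])\big)\le\Phi\big(x_1(\varphi(tD)[P]),\ldots,x_n(\varphi(tD)[P])\big)$$ whenever $P\in\mathcal{H}_n$. In particular, the inequalities $$\sum_{i=1}^nf\big(x_i(\varphi(sD)[P])\big)\le\sum_{i=1}^nf\big(x_i(\varphi(tD)[P])\big),\qquad\sum_{i=1}^nf\big(x_i(P)\big)\le\sum_{i=1}^nf\big(x_i(\varphi(tD)[P])\big)$$ hold for any convex function $f:\mathbb{R}\to\mathbb{R}$.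
   Context: $\mathcal{H}_n$ denotes the set of monic univariate polynomials of degree $n$ all of whose zeros are real. For a polynomial $P$ of degree $n\ge1$, $x_1(P),\dots,x_n(P)$ denote its zeros counted with multiplicity. For real $n$-tuples $X,Y$ write $X\prec Y$ (majorization) if $\sum_{i=1}^n f(x_i)\le\sum_{i=1}^n f(y_i)$ for every convex $f:\mathbb{R}\to\mathbb{R}$ (equivalently, $X=AY$ as column vectors for some doubly stochastic matrix $A$). A function $\Phi:\mathbb{R}^n\to\mathbb{R}$ is Schur-convex if $\Phi(X)\le\Phi(Y)$ whenever $X\prec Y$. $\mathcal{LP}_0'$ is the class of entire functions of the form $\varphi(x)=ce^{-a^2x^2}\prod_{k=1}^\infty(1-\alpha_kx)e^{\alpha_kx}$ with $a,c,\alpha_k\in\mathbb{R}$, $c\ne0$ and $\sum_k\alpha_k^2<\infty$. With $D=d/dx$ and $\varphi(x)=\sum_ka_kx^k$, put $\varphi(sD)[P]=\sum_ka_ks^kP^{(k)}$ for polynomials $P$. (By a classical theorem of Pólya, for $P\in\mathcal{H}_n$ the degree-$n$ polynomial $\varphi(sD)[P]$ has only real zeros.) *)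

theory Defs
  imports
    "HOL-Complex_Analysis.Complex_Analysis"
    "HOL-Computational_Algebra.Computational_Algebra"
begin

text \<open>Polynomials are taken over the complex numbers, so that "all zeros are real" speaks about
  all zeros; such a monic polynomial automatically has real coefficients.\<close>

definition hyperbolic_polys :: "nat \<Rightarrow> complex poly set" where
  "hyperbolic_polys n =
     {P. degree P = n \<and> lead_coeff P = 1 \<and> (\<forall>z. poly P z = 0 \<longrightarrow> z \<in> \<real>)}"

text \<open>The real tuple \<open>X\<close> lists all complex zeros of \<open>P\<close> with multiplicity, in some order. For
  \<open>P \<noteq> 0\<close> this forces all zeros of \<open>P\<close> to be real and \<open>degree P = CARD('n)\<close>.\<close>

definition is_zero_tuple :: "complex poly \<Rightarrow> real ^ 'n \<Rightarrow> bool" where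
  "is_zero_tuple P X \<longleftrightarrow>
     proots P = image_mset (\<lambda>i. complex_of_real (X $ i)) (mset_set (UNIV :: 'n set))"

definition majorized :: "real ^ 'n \<Rightarrow> real ^ 'n \<Rightarrow> bool" where
  "majorized X Y \<longleftrightarrow>
     (\<forall>f :: real \<Rightarrow> real. convex_on UNIV f \<longrightarrow> (\<Sum>i\<in>UNIV. f (X $ i)) \<le> (\<Sum>i\<in>UNIV. f (Y $ i)))"

definition schur_convex :: "(real ^ 'n \<Rightarrow> real) \<Rightarrow> bool" where
  "schur_convex \<Phi> \<longleftrightarrow> (\<forall>X Y. majorized X Y \<longrightarrow> \<Phi> X \<le> \<Phi> Y)"

text \<open>Square-summability of \<open>\<alpha>\<close> makes the infinite product converge at every point, so
  \<^const>\<open>prodinf\<close> takes its intended value there (also at the zeros of the factors). Finite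
  products are covered by sequences \<open>\<alpha>\<close> that are eventually zero.\<close>

definition LP0' :: "(complex \<Rightarrow> complex) set" where
  "LP0' = {\<phi>. \<exists>(a::real) (c::real) (\<alpha> :: nat \<Rightarrow> real).
     c \<noteq> 0 \<and> summable (\<lambda>k. (\<alpha> k)\<^sup>2) \<and>
     (\<forall>z. \<phi> z = of_real c * exp (- (of_real a)\<^sup>2 * z\<^sup>2) *
             (\<Prod>k. (1 - of_real (\<alpha> k) * z) * exp (of_real (\<alpha> k) * z)))}"

text \<open>The operator \<open>\<phi>(sD)\<close>: \<^const>\<open>fps_expansion\<close> supplies the Taylor coefficients of \<open>\<phi>\<close> at 0,
  and the derivatives of order greater than \<open>degree P\<close> vanish.\<close>

definition diff_op :: "(complex \<Rightarrow> complex) \<Rightarrow> real \<Rightarrow> complex poly \<Rightarrow> complex poly" where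
  "diff_op \<phi> s P =
     (\<Sum>k\<le>degree P. smult (fps_nth (fps_expansion \<phi> 0) k * of_real s ^ k) ((pderiv ^^ k) P))"

end

theory Submission
  imports Defs
begin

text \<open>Up to a constant, \<open>\<phi>(tD)\<close> is a coefficientwise limit of products of the commuting operators
  \<open>(1 - bD) exp(bD)\<close>; the Gaussian is the limit of \<open>(1 - a\<^sup>2 x\<^sup>2 / m)\<^sup>m\<close>. For polynomials of fixed
  degree, hyperbolicity and the majorization inequality between the dilates pass to products and,
  by compactness of the zero tuples, to limits, so a single factor suffices.

  If \<open>Q\<close> has zeros \<open>q\<^sub>i\<close>, the zeros of \<open>(1 - bD) exp(bD) Q\<close> are the eigenvalues of
  \<open>diag(q) + b (J - I)\<close> with \<open>J\<close> the all-ones matrix. For convex \<open>f\<close> the trace of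
  \<open>f(diag(q) + r b (J - I))\<close> is convex in \<open>r\<close> and minimal at \<open>r = 0\<close>, because \<open>J - I\<close> has zero diagonal;
  hence it is nondecreasing in \<open>r \<ge> 0\<close>. For distinct \<open>q\<^sub>i\<close> the eigenvectors are explicit, and
  repeated zeros are handled by perturbation.\<close>

no_notation fps_nth (infixl "$" 75)

section \<open>Power series in the derivative\<close>

text \<open>\<open>diff_op\<close> with an arbitrary formal series: composition of operators becomes
  multiplication of series, and limits can be taken coefficient by coefficient.\<close>

definition fps_op :: "complex fps \<Rightarrow> complex poly \<Rightarrow> complex poly" where
  "fps_op F P = (\<Sum>k\<le>degree P. smult (fps_nth F k) ((pderiv ^^ k) P))"

definition dilate :: "real \<Rightarrow> complex fps \<Rightarrow> complex fps" where
  "dilate r F = F oo (fps_const (of_real r) * fps_X)"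

lemma dilate_nth [simp]: "fps_nth (dilate r F) k = of_real r ^ k * fps_nth F k"
  by (simp add: dilate_def fps_compose_linear)

lemma dilate_mult: "dilate r (F * G) = dilate r F * dilate r G"
  unfolding dilate_def by (rule fps_compose_mult_distrib) simp

lemma smult_sum_right: "smult c (\<Sum>x\<in>A. f x) = (\<Sum>x\<in>A. smult c (f x :: complex poly))"
  by (induction A rule: infinite_finite_induct) (simp_all add: smult_add_right)

lemma higher_pderiv_eq_0: "degree P < k \<Longrightarrow> (pderiv ^^ k) P = (0 :: complex poly)"
  by (intro poly_eqI) (simp add: coeff_higher_pderiv coeff_eq_0)

lemma fps_op_bound:
  assumes "degree P \<le> N"
  shows "fps_op F P = (\<Sum>k\<le>N. smult (fps_nth F k) ((pderiv ^^ k) P))"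
  unfolding fps_op_def using assms
  by (intro sum.mono_neutral_left) (auto simp: higher_pderiv_eq_0)

lemma diff_op_dilate: "diff_op \<phi> s P = fps_op (dilate s (fps_expansion \<phi> 0)) P"
  by (simp add: diff_op_def fps_op_def mult.commute)

lemma degree_fps_op_le: "degree (fps_op F P) \<le> degree P"
  unfolding fps_op_def
  by (rule degree_sum_le) (auto intro!: order.trans[OF degree_smult_le] simp: degree_higher_pderiv)

text \<open>Every derivative lowers the degree, so only the constant term of \<open>F\<close>
  reaches the top coefficient; with constant term 1 the operator keeps polynomials monic.\<close>

lemma coeff_fps_op_degree: "coeff (fps_op F P) (degree P) = fps_nth F 0 * lead_coeff P"
proof -
  have "coeff (fps_op F P) (degree P) =
    (\<Sum>k\<le>degree P. if k = 0 then fps_nth F 0 * lead_coeff P else 0)"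
    unfolding fps_op_def coeff_sum
    by (intro sum.cong) (auto simp: coeff_higher_pderiv coeff_eq_0)
  then show ?thesis by simp
qed

lemma fps_op_const [simp]: "fps_op (fps_const c) P = smult c P"
proof -
  have "fps_op (fps_const c) P = (\<Sum>k\<le>degree P. if k = 0 then smult c P else 0)"
    unfolding fps_op_def by (intro sum.cong) auto
  then show ?thesis by simp
qed

lemma fps_op_1 [simp]: "fps_op 1 P = P"
  using fps_op_const[of 1] by (simp del: fps_op_const)

lemma fps_op_mult: "fps_op (F * G) P = fps_op F (fps_op G P)"
proof -
  define N where "N = degree P"
  let ?g = "\<lambda>i j. smult (fps_nth F i * fps_nth G j) ((pderiv ^^ (i + j)) P)"
  have "fps_op F (fps_op G P) = (\<Sum>i\<le>N. smult (fps_nth F i) ((pderiv ^^ i) (fps_op G P)))"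
    using degree_fps_op_le[of G P] by (intro fps_op_bound) (simp add: N_def)
  also have "\<dots> = (\<Sum>i\<le>N. \<Sum>j\<le>N. ?g i j)"
    by (simp add: fps_op_def N_def higher_pderiv_sum higher_pderiv_smult smult_sum_right funpow_add)
  also have "\<dots> = (\<Sum>(i,j)\<in>{..N}\<times>{..N}. ?g i j)"
    by (rule sum.cartesian_product)
  \<comment> \<open>Outside the triangle the order \<open>i + j\<close> exceeds the degree of
    \<open>P\<close>, so the derivative is zero.\<close>
  also have "\<dots> = (\<Sum>(i,j)\<in>{(i,j). i + j \<le> N}. ?g i j)"
    by (intro sum.mono_neutral_right) (auto simp: N_def, metis higher_pderiv_eq_0 not_le)
  also have "\<dots> = (\<Sum>k\<le>N. \<Sum>i\<le>k. ?g i (k - i))"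
    by (rule sum.triangle_reindex_eq)
  also have "\<dots> = fps_op (F * G) P"
    unfolding fps_op_def N_def fps_mult_nth smult_sum by (intro sum.cong) (auto simp: atLeast0AtMost)
  finally show ?thesis by simp
qed

lemma fps_op_linear: "fps_op (1 - fps_const b * fps_X) P = P - smult b (pderiv P)"
proof -
  have "fps_op (1 - fps_const b * fps_X) P =
    (\<Sum>k\<le>Suc (degree P). smult (fps_nth (1 - fps_const b * fps_X) k) ((pderiv ^^ k) P))"
    by (rule fps_op_bound) simp
  also have "\<dots> = (\<Sum>k\<in>{0,1}. smult (fps_nth (1 - fps_const b * fps_X) k) ((pderiv ^^ k) P))"
    by (intro sum.mono_neutral_right) auto
  finally show ?thesis by simp
qed

text \<open>Leibniz rule for \<open>x * p\<close>; the constant \<open>a\<close> disappears with the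
  first derivative.\<close>

lemma higher_pderiv_pCons:
  "(pderiv ^^ Suc k) (pCons a p) =
     pCons 0 ((pderiv ^^ Suc k) p) + smult (of_nat (Suc k)) ((pderiv ^^ k) (p :: complex poly))"
proof (induction k)
  case (Suc k)
  have "(pderiv ^^ Suc (Suc k)) (pCons a p) = pderiv ((pderiv ^^ Suc k) (pCons a p))"
    by simp
  also have "\<dots> = (pderiv ^^ Suc k) p + pCons 0 ((pderiv ^^ Suc (Suc k)) p)
      + smult (of_nat (Suc k)) ((pderiv ^^ Suc k) p)"
    unfolding Suc by (simp add: pderiv_pCons pderiv_add pderiv_smult)
  also have "\<dots> = pCons 0 ((pderiv ^^ Suc (Suc k)) p) +
      smult (of_nat (Suc (Suc k))) ((pderiv ^^ Suc k) p)"
    by (subst of_nat_Suc, subst smult_add_left) simp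
  finally show ?case .
qed (simp add: pderiv_pCons)

text \<open>Taylor's formula: exp(bD) is translation by \<open>b\<close>. The induction rests on
  exp(bD)(a + x p) = a + (x + b) exp(bD) p.\<close>

lemma fps_op_exp: "fps_op (fps_exp b) P = pcompose P [:b, 1:]"
proof (induction P)
  case 0
  show ?case by (simp add: fps_op_def)
next
  case (pCons a p)
  let ?E = "fps_exp b :: complex fps"
  define d where "d = degree p"
  \<comment> \<open>The differential equation E' = b E of the exponential series, read
    coefficientwise.\<close>
  have coeff: "fps_nth ?E (Suc k) * of_nat (Suc k) = b * fps_nth ?E k" for k
    using fps_deriv_nth[of ?E k] by (simp add: mult.commute)
  have "fps_op ?E (pCons a p) = (\<Sum>k\<le>Suc d. smult (fps_nth ?E k) ((pderiv ^^ k) (pCons a p)))"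
    by (rule fps_op_bound) (simp add: d_def degree_pCons_le)
  also have "\<dots> = pCons a p + (\<Sum>k\<le>d. smult (fps_nth ?E (Suc k)) ((pderiv ^^ Suc k) (pCons a p)))"
    by (subst sum.atMost_Suc_shift) simp
  also have "\<dots> = pCons a p + (\<Sum>k\<le>d. pCons 0 (smult (fps_nth ?E (Suc k)) ((pderiv ^^ Suc k) p)))
      + smult b (\<Sum>k\<le>d. smult (fps_nth ?E k) ((pderiv ^^ k) p))"
    unfolding higher_pderiv_pCons smult_add_right smult_smult coeff smult_sum_right
    by (simp add: sum.distrib)
  also have "(\<Sum>k\<le>d. pCons 0 (smult (fps_nth ?E (Suc k)) ((pderiv ^^ Suc k) p))) =
      pCons 0 (\<Sum>k\<le>d. smult (fps_nth ?E (Suc k)) ((pderiv ^^ Suc k) p))"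
    by (induction d) simp_all
  also have "pCons a p + \<dots> = [:a:] + pCons 0 (\<Sum>k\<le>Suc d. smult (fps_nth ?E k) ((pderiv ^^ k) p))"
    by (subst sum.atMost_Suc_shift) simp
  also have "(\<Sum>k\<le>Suc d. smult (fps_nth ?E k) ((pderiv ^^ k) p)) = fps_op ?E p"
    by (rule fps_op_bound[symmetric]) (simp add: d_def)
  also have "(\<Sum>k\<le>d. smult (fps_nth ?E k) ((pderiv ^^ k) p)) = fps_op ?E p"
    by (simp add: fps_op_def d_def)
  finally show ?case using pCons by (simp add: pcompose_pCons algebra_simps)
qed

section \<open>Hyperbolic polynomials and their limits\<close>

definition zeros_poly :: "real ^ 'n \<Rightarrow> complex poly" where
  "zeros_poly X = (\<Prod>i\<in>UNIV. [:- of_real (X $ i), 1:])"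

definition zero_sum :: "(real \<Rightarrow> real) \<Rightarrow> complex poly \<Rightarrow> real" where
  "zero_sum f P = (\<Sum>x\<in>#proots P. f (Re x))"

lemma poly_zeros_poly: "poly (zeros_poly X) z = (\<Prod>i\<in>UNIV. z - of_real (X $ i))"
  by (simp add: zeros_poly_def poly_prod)

lemma degree_zeros_poly [simp]: "degree (zeros_poly (X :: real ^ 'n)) = CARD('n)"
  unfolding zeros_poly_def by (subst degree_prod_sum_eq) auto

lemma lead_coeff_zeros_poly [simp]: "lead_coeff (zeros_poly X) = 1"
  unfolding zeros_poly_def by (subst lead_coeff_prod) simp

lemma coeff_zeros_poly_card [simp]: "coeff (zeros_poly (X :: real ^ 'n)) (CARD('n)) = 1"
  using lead_coeff_zeros_poly[of X] by simp

lemma is_zero_tuple_zeros_poly: "is_zero_tuple (zeros_poly X) X"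
proof -
  have "proots (zeros_poly X) = (\<Sum>i\<in>UNIV. {#of_real (X $ i)#})"
    unfolding zeros_poly_def by (subst proots_prod) auto
  also have "\<dots> = image_mset (\<lambda>i. of_real (X $ i)) (mset_set UNIV)"
    by (simp add: sum_unfold_sum_mset)
  finally show ?thesis by (simp add: is_zero_tuple_def)
qed

lemma zero_sum_zero_tuple:
  "is_zero_tuple P X \<Longrightarrow> zero_sum f P = (\<Sum>i\<in>UNIV. f (X $ i))"
  by (simp add: is_zero_tuple_def zero_sum_def sum_unfold_sum_mset image_mset.compositionality o_def)

lemma zero_sum_zeros_poly [simp]: "zero_sum f (zeros_poly X) = (\<Sum>i\<in>UNIV. f (X $ i))"
  by (rule zero_sum_zero_tuple[OF is_zero_tuple_zeros_poly])

lemma poly_zeros_poly_eq_0_iff: "poly (zeros_poly X) z = 0 \<longleftrightarrow> (\<exists>i. z = of_real (X $ i))"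
  by (auto simp: poly_zeros_poly)

lemma zeros_poly_in_hyperbolic [intro]:
  "zeros_poly (X :: real ^ 'n) \<in> hyperbolic_polys CARD('n)"
  unfolding hyperbolic_polys_def using lead_coeff_zeros_poly[of X]
  by (auto simp: poly_zeros_poly_eq_0_iff)

text \<open>The fundamental theorem of algebra splits \<open>P\<close>, and its real roots are
  reindexed by \<open>'n\<close>. Hyperbolic polynomials can then be treated as vectors, where
  compactness is available.\<close>

lemma hyperbolic_zeros_poly:
  assumes "P \<in> hyperbolic_polys CARD('n)"
  obtains X :: "real ^ 'n" where "P = zeros_poly X"
proof -
  have P: "degree P = CARD('n)" "lead_coeff P = 1" "\<And>z. poly P z = 0 \<Longrightarrow> z \<in> \<real>"
    using assms by (auto simp: hyperbolic_polys_def)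
  obtain root where "smult (lead_coeff P) (\<Prod>i<degree P. [:- root i, 1:]) = P"
    using complex_poly_decompose' by metis
  then have root: "P = (\<Prod>i<CARD('n). [:- root i, 1:])" using P by simp
  obtain h where h: "bij_betw h (UNIV :: 'n set) {..<CARD('n)}"
    using ex_bij_betw_finite_nat[of "UNIV :: 'n set"] by (auto simp: atLeast0LessThan)
  have real: "root i \<in> \<real>" if "i < CARD('n)" for i
    by (rule P(3)) (use that in \<open>auto simp: root poly_prod\<close>)
  have "P = (\<Prod>i\<in>UNIV. [:- root (h i), 1:])"
    unfolding root by (rule prod.reindex_bij_betw[OF h, symmetric])
  also have "\<dots> = zeros_poly (\<chi> i. Re (root (h i)))"
    unfolding zeros_poly_def
  proof (intro prod.cong refl)
    fix i
    have "h i < CARD('n)" using h by (auto simp: bij_betw_def)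
    then show "[:- root (h i), 1:] = [:- of_real ((\<chi> i. Re (root (h i))) $ i), 1:]"
      using real by simp
  qed
  finally show ?thesis using that by blast
qed

section \<open>Root bounds and coefficientwise convergence\<close>

text \<open>If |z| > 1, the leading term of size |z|^n is balanced by n lower terms, each at most C
  |z|^(n-1). The summand 1 covers the remaining \<open>z\<close>.\<close>

lemma monic_root_bound:
  fixes P :: "complex poly" and C :: real
  assumes "lead_coeff P = 1" "poly P z = 0" "\<And>k. norm (coeff P k) \<le> C"
  shows "norm z \<le> 1 + degree P * C"
proof (cases "norm z \<le> 1")
  case True
  moreover have "C \<ge> 0" using assms(3) norm_ge_zero order_trans by blast
  ultimately show ?thesis by (simp add: add_increasing2)
next
  case False
  define n where "n = degree P"
  have "n \<noteq> 0" using assms unfolding n_def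
    by (metis degree_eq_zeroE lead_coeff_pCons(2) one_neq_zero pCons_0_0 poly_const_conv)
  then obtain m where m: "n = Suc m" by (cases n) auto
  have "0 = (\<Sum>k\<le>n. coeff P k * z ^ k)"
    using assms by (simp add: poly_altdef n_def)
  also have "\<dots> = (\<Sum>k\<le>m. coeff P k * z ^ k) + z ^ n"
    using assms by (simp add: m flip: n_def)
  finally have "norm (z ^ n) = norm (\<Sum>k\<le>m. coeff P k * z ^ k)"
    by (metis add.commute add_eq_0_iff norm_minus_cancel)
  also have "\<dots> \<le> (\<Sum>k\<le>m. C * norm z ^ m)"
    by (rule sum_norm_le) (use False assms(3) in
      \<open>auto simp: norm_mult norm_power intro!: mult_mono power_increasing order.trans[OF norm_ge_zero assms(3)]\<close>)
  also have "\<dots> = (n * C) * norm z ^ m" by (simp add: m)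
  finally have "norm z * norm z ^ m \<le> (n * C) * norm z ^ m"
    by (simp add: m norm_mult norm_power)
  moreover have "norm z ^ m > 0" using False by (intro zero_less_power) linarith
  ultimately have "norm z \<le> n * C" by (rule mult_right_le_imp_le)
  then show ?thesis by (simp add: n_def)
qed

definition coeffs_lim :: "(nat \<Rightarrow> complex poly) \<Rightarrow> complex poly \<Rightarrow> bool" where
  "coeffs_lim P Q \<longleftrightarrow> (\<forall>k. (\<lambda>m. coeff (P m) k) \<longlonglongrightarrow> coeff Q k)"

lemma coeffs_lim_prod:
  assumes "\<And>i. i \<in> A \<Longrightarrow> coeffs_lim (\<lambda>m. P m i) (Q i)"
  shows "coeffs_lim (\<lambda>m. \<Prod>i\<in>A. P m i) (\<Prod>i\<in>A. Q i)"
  using assms unfolding coeffs_lim_def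
  by (induction A rule: infinite_finite_induct) (auto simp: coeff_mult intro!: tendsto_intros)

lemma coeffs_lim_zeros_poly:
  assumes "X \<longlonglongrightarrow> Y"
  shows "coeffs_lim (\<lambda>m. zeros_poly (X m)) (zeros_poly Y)"
  unfolding zeros_poly_def
proof (rule coeffs_lim_prod)
  show "coeffs_lim (\<lambda>m. [:- of_real (X m $ i), 1:]) [:- of_real (Y $ i), 1:]" for i
    unfolding coeffs_lim_def coeff_pCons using assms
    by (auto split: nat.split intro!: tendsto_intros)
qed

lemma coeffs_lim_subseq: "coeffs_lim P Q \<Longrightarrow> strict_mono r \<Longrightarrow> coeffs_lim (P \<circ> r) Q"
  unfolding coeffs_lim_def
  using LIMSEQ_subseq_LIMSEQ[of "\<lambda>m. coeff (P m) k" "coeff Q k" r for k] by (auto simp: o_def)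

lemma coeffs_lim_unique: "coeffs_lim P Q \<Longrightarrow> coeffs_lim P R \<Longrightarrow> Q = R"
  unfolding coeffs_lim_def by (intro poly_eqI) (blast intro: LIMSEQ_unique)

text \<open>Convergent coefficients are bounded and only finitely many can be nonzero, so a single
  constant enters \<open>monic_root_bound\<close>.\<close>

lemma zeros_poly_lim_bounded:
  fixes X :: "nat \<Rightarrow> real ^ 'n"
  assumes "coeffs_lim (\<lambda>m. zeros_poly (X m)) P"
  shows "bounded (range X)"
proof -
  have "\<exists>C. \<forall>m. norm (coeff (zeros_poly (X m)) k) \<le> C" for k
    using assms convergent_imp_bounded[of "\<lambda>m. coeff (zeros_poly (X m)) k"]
    unfolding coeffs_lim_def by (auto simp: bounded_iff)
  then obtain C where C: "\<And>k m. norm (coeff (zeros_poly (X m)) k) \<le> C k" by metis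
  define D where "D = (\<Sum>k\<le>CARD('n). C k)"
  have C0: "C k \<ge> 0" for k using C[of _ k] norm_ge_zero order_trans by blast
  have D: "norm (coeff (zeros_poly (X m)) k) \<le> D" for k m
  proof (cases "k \<le> CARD('n)")
    case True
    then have "C k \<le> D" unfolding D_def using C0 by (intro member_le_sum) auto
    then show ?thesis using C order_trans by blast
  next
    case False
    then show ?thesis using C0 by (simp add: coeff_eq_0 D_def sum_nonneg)
  qed
  have "norm (X m $ i) \<le> 1 + CARD('n) * D" for m i
    using monic_root_bound[OF _ _ D, of m "of_real (X m $ i)"]
    by (auto simp: poly_zeros_poly_eq_0_iff)
  then have "norm (X m) \<le> (\<Sum>i\<in>(UNIV::'n set). 1 + CARD('n) * D)" for m
    using norm_le_l1_cart[of "X m"] by (smt (verit) sum_mono real_norm_def)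
  then show ?thesis by (auto simp: bounded_iff)
qed

text \<open>The zero vectors are bounded, hence converge along a subsequence, and uniqueness of
  coefficient limits makes their limits the zeros of \<open>P\<close> and \<open>Q\<close>. Convex
  functions on the line are continuous, so the inequality survives.\<close>

lemma hyperbolic_lim:
  fixes X Y :: "nat \<Rightarrow> real ^ 'n"
  assumes P: "coeffs_lim (\<lambda>m. zeros_poly (X m)) P" and Q: "coeffs_lim (\<lambda>m. zeros_poly (Y m)) Q"
  shows "P \<in> hyperbolic_polys CARD('n) \<and> Q \<in> hyperbolic_polys CARD('n) \<and>
    (\<forall>f. convex_on UNIV f \<and> (\<forall>m. zero_sum f (zeros_poly (X m)) \<le> zero_sum f (zeros_poly (Y m)))
       \<longrightarrow> zero_sum f P \<le> zero_sum f Q)"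
proof -
  \<comment> \<open>Pairs are used so that one subsequence serves both sides of the
    inequality.\<close>
  have "bounded (range (\<lambda>m. (X m, Y m)))"
    by (rule bounded_subset[OF bounded_Times[OF zeros_poly_lim_bounded[OF P] zeros_poly_lim_bounded[OF Q]]])
      auto
  then obtain l r where r: "strict_mono r" and l: "((\<lambda>m. (X m, Y m)) \<circ> r) \<longlonglongrightarrow> l"
    using bounded_imp_convergent_subsequence by blast
  have X: "(\<lambda>m. X (r m)) \<longlonglongrightarrow> fst l" and Y: "(\<lambda>m. Y (r m)) \<longlonglongrightarrow> snd l"
    using tendsto_fst[OF l] tendsto_snd[OF l] by (simp_all add: o_def)
  have PX: "P = zeros_poly (fst l)"
    using coeffs_lim_zeros_poly[OF X] coeffs_lim_subseq[OF P r]
    by (auto simp: o_def intro: coeffs_lim_unique)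
  have QY: "Q = zeros_poly (snd l)"
    using coeffs_lim_zeros_poly[OF Y] coeffs_lim_subseq[OF Q r]
    by (auto simp: o_def intro: coeffs_lim_unique)
  have "zero_sum f P \<le> zero_sum f Q" if f: "convex_on UNIV f"
    and le: "\<And>m. zero_sum f (zeros_poly (X m)) \<le> zero_sum f (zeros_poly (Y m))" for f
  proof -
    have cont: "isCont f x" for x
      using convex_on_continuous[OF open_UNIV f] by (simp add: continuous_on_eq_continuous_at)
    have lim: "(\<lambda>m. \<Sum>i\<in>UNIV. f (Z m $ i)) \<longlonglongrightarrow> (\<Sum>i\<in>UNIV. f (W $ i))"
      if "Z \<longlonglongrightarrow> W" for Z :: "nat \<Rightarrow> real ^ 'n" and W :: "real ^ 'n"
      by (intro tendsto_sum isCont_tendsto_compose[OF cont] tendsto_vec_nth that)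
    show ?thesis unfolding PX QY zero_sum_zeros_poly
      by (rule LIMSEQ_le[OF lim[OF X] lim[OF Y]]) (use le in auto)
  qed
  then show ?thesis using PX QY by auto
qed

text \<open>The common degree bound \<open>N\<close> turns all operators into sums over one fixed
  finite index set.\<close>

lemma coeffs_lim_fps_op:
  assumes "\<And>k. (\<lambda>m. fps_nth (F m) k) \<longlonglongrightarrow> fps_nth G k" "coeffs_lim P Q"
    "\<And>m. degree (P m) \<le> N" "degree Q \<le> N"
  shows "coeffs_lim (\<lambda>m. fps_op (F m) (P m)) (fps_op G Q)"
  unfolding coeffs_lim_def fps_op_bound[OF assms(3)] fps_op_bound[OF assms(4)] coeff_sum
  using assms(1,2) by (auto simp: coeff_higher_pderiv coeffs_lim_def intro!: tendsto_intros)

section \<open>The factor 1 - bD\<close>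

lemma poly_pderiv_zeros_poly:
  "poly (pderiv (zeros_poly X)) z = (\<Sum>i\<in>UNIV. \<Prod>j\<in>UNIV - {i}. z - of_real (X $ j))"
  by (simp add: zeros_poly_def pderiv_prod poly_sum poly_prod pderiv_pCons)

lemma poly_pderiv_zeros_poly_nonroot:
  assumes "\<And>i. z \<noteq> of_real (X $ i)"
  shows "poly (pderiv (zeros_poly X)) z =
    poly (zeros_poly X) z * (\<Sum>i\<in>UNIV. 1 / (z - of_real (X $ i)))"
proof -
  have "(\<Prod>j\<in>UNIV - {i}. z - of_real (X $ j)) =
      (\<Prod>j\<in>UNIV. z - of_real (X $ j)) * (1 / (z - of_real (X $ i)))" (is "?p = ?q * _") for i
  proof -
    have "?q = (z - of_real (X $ i)) * ?p" by (rule prod.remove) auto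
    moreover have "z - of_real (X $ i) \<noteq> 0" using assms[of i] by simp
    ultimately show ?thesis by (simp add: field_simps)
  qed
  then show ?thesis
    unfolding poly_pderiv_zeros_poly poly_zeros_poly sum_distrib_left by (intro sum.cong refl)
qed

text \<open>Only the summand omitting the factor \<open>i\<close> survives. For distinct zeros the
  value is nonzero, which separates the zeros of Q - bQ' from those of Q.\<close>

lemma poly_pderiv_zeros_poly_root:
  "poly (pderiv (zeros_poly X)) (of_real (X $ i)) = of_real (\<Prod>j\<in>UNIV - {i}. X $ i - X $ j)"
proof -
  have "poly (pderiv (zeros_poly X)) (of_real (X $ i)) =
    (\<Sum>k\<in>UNIV. if k = i then of_real (\<Prod>j\<in>UNIV - {i}. X $ i - X $ j) else 0)"
    unfolding poly_pderiv_zeros_poly by (intro sum.cong) (auto simp: prod_zero_iff)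
  then show ?thesis by simp
qed

text \<open>Since Q and Q - bQ' share no zero, division by Q turns the equation for a zero z of Q -
  bQ' into: the sum of 1/(z - q_i) equals 1/b.\<close>

lemma linear_op_hyperbolic:
  fixes q :: "real ^ 'n"
  assumes inj: "inj (\<lambda>i. q $ i)" and b: "b \<noteq> 0"
  obtains y :: "real ^ 'n" where
    "zeros_poly q - smult (of_real b) (pderiv (zeros_poly q)) = zeros_poly y"
    "\<And>i j. y $ j \<noteq> q $ i" "\<And>j. (\<Sum>i\<in>UNIV. 1 / (y $ j - q $ i)) = 1 / b"
proof -
  define R where "R = zeros_poly q - smult (of_real b) (pderiv (zeros_poly q))"
  have R: "R = fps_op (1 - fps_const (of_real b) * fps_X) (zeros_poly q)"
    by (simp add: R_def fps_op_linear)
  have "coeff R CARD('n) = 1"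
    using coeff_fps_op_degree[of "1 - fps_const (of_real b) * fps_X" "zeros_poly q"] by (simp add: R)
  moreover have "degree R \<le> CARD('n)"
    using degree_fps_op_le[of _ "zeros_poly q"] by (simp add: R)
  ultimately have monic: "degree R = CARD('n)" "lead_coeff R = 1"
    by (metis le_antisym le_degree zero_neq_one)+
  have nonroot: "z \<noteq> of_real (q $ i)" if "poly R z = 0" for z i
  proof
    assume z: "z = of_real (q $ i)"
    moreover have "poly (zeros_poly q) (of_real (q $ i)) = 0"
      by (auto simp: poly_zeros_poly_eq_0_iff)
    ultimately have "poly (pderiv (zeros_poly q)) (of_real (q $ i)) = 0"
      using that b by (simp add: R_def)
    then show False
      using inj unfolding poly_pderiv_zeros_poly_root by (auto simp: inj_on_def)
  qed
  have sum: "(\<Sum>i\<in>UNIV. 1 / (z - of_real (q $ i))) = 1 / of_real b" if "poly R z = 0" for z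
  proof -
    have "poly (zeros_poly q) z \<noteq> 0"
      using nonroot[OF that] by (auto simp: poly_zeros_poly_eq_0_iff)
    moreover have "poly (zeros_poly q) z * (1 - b * (\<Sum>i\<in>UNIV. 1 / (z - of_real (q $ i)))) = 0"
      using that poly_pderiv_zeros_poly_nonroot[OF nonroot[OF that]]
      by (simp add: R_def algebra_simps)
    ultimately show ?thesis using b by (simp add: field_simps)
  qed
  have real: "z \<in> \<real>" if "poly R z = 0" for z
  proof (rule ccontr)
    assume "z \<notin> \<real>"
    then have im: "Im z \<noteq> 0" by (simp add: complex_is_Real_iff)
    \<comment> \<open>Every summand has imaginary part of sign opposite to that of
      \<open>Im z\<close>, whereas 1/b is real.\<close>
    have "Im (1 / (z - of_real a)) = - Im z / (norm (z - of_real a))\<^sup>2" for a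
      by (simp add: Im_divide cmod_power2)
    then have "Im (\<Sum>i\<in>UNIV. 1 / (z - of_real (q $ i))) =
        - Im z * (\<Sum>i\<in>UNIV. 1 / (norm (z - of_real (q $ i)))\<^sup>2)"
      by (simp add: sum_distrib_left)
    moreover have "Im (\<Sum>i\<in>UNIV. 1 / (z - of_real (q $ i))) = 0"
      unfolding sum[OF that] by (metis Im_complex_of_real of_real_1 of_real_divide)
    moreover have "(\<Sum>i\<in>(UNIV::'n set). 1 / (norm (z - of_real (q $ i)))\<^sup>2) > 0"
      by (intro sum_pos) (use nonroot[OF that] in auto)
    ultimately show False using im by simp
  qed
  obtain y :: "real ^ 'n" where y: "R = zeros_poly y"
    by (rule hyperbolic_zeros_poly[of R]) (use monic real in \<open>auto simp: hyperbolic_polys_def\<close>)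
  have root: "poly R (of_real (y $ j)) = 0" for j
    by (auto simp: y poly_zeros_poly_eq_0_iff)
  show ?thesis
  proof (rule that[of y])
    show "y $ j \<noteq> q $ i" for i j
      using nonroot[OF root[of j], of i] by simp
    have "complex_of_real (\<Sum>i\<in>UNIV. 1 / (y $ j - q $ i)) = of_real (1 / b)" for j
      using sum[OF root[of j]] by simp
    then show "(\<Sum>i\<in>UNIV. 1 / (y $ j - q $ i)) = 1 / b" for j
      by (simp only: of_real_eq_iff)
  qed (simp flip: y add: R_def)
qed

text \<open>A double zero would be a critical point of 1 - b sum 1/(x - q_i), whose derivative b sum
  1/(x - q_i)^2 is nonzero at real x off the q_i. The proof divides by x - y_a instead of
  differentiating.\<close>

lemma linear_op_simple:
  fixes q y :: "real ^ 'n"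
  assumes eq: "zeros_poly q - smult (of_real b) (pderiv (zeros_poly q)) = zeros_poly y"
    and ne: "\<And>i j. y $ j \<noteq> q $ i" and sum: "\<And>j. (\<Sum>i\<in>UNIV. 1 / (y $ j - q $ i)) = 1 / b"
    and b: "b \<noteq> 0"
  shows "inj (\<lambda>j. y $ j)"
proof (rule injI, rule ccontr)
  fix a a' assume aa: "y $ a = y $ a'" "a \<noteq> a'"
  \<comment> \<open>\<open>L\<close> and \<open>M\<close> are the quotients by x - y_a of two
    expressions for Q - bQ'. A repeated zero makes \<open>L\<close> vanish at y_a, while
    \<open>M\<close> cannot.\<close>
  define L where "L = (\<lambda>x. \<Prod>j\<in>UNIV - {a}. x - y $ j)"
  define M where "M = (\<lambda>x. b * (\<Prod>i\<in>UNIV. x - q $ i) *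
    (\<Sum>i\<in>UNIV. 1 / ((y $ a - q $ i) * (x - q $ i))))"
  have LM: "L x = M x" if x: "x \<noteq> y $ a" "\<forall>i. x \<noteq> q $ i" for x
  proof -
    have "complex_of_real (\<Prod>j\<in>UNIV. x - y $ j) = poly (zeros_poly y) (of_real x)"
      by (simp add: poly_zeros_poly)
    also have "\<dots> = poly (zeros_poly q) (of_real x) *
        (1 - of_real b * (\<Sum>i\<in>UNIV. 1 / (of_real x - of_real (q $ i))))"
      unfolding eq[symmetric] using x(2)
      by (simp add: poly_pderiv_zeros_poly_nonroot algebra_simps)
    also have "\<dots> = of_real ((\<Prod>i\<in>UNIV. x - q $ i) * (1 - b * (\<Sum>i\<in>UNIV. 1 / (x - q $ i))))"
      by (simp add: poly_zeros_poly)
    finally have "(\<Prod>j\<in>UNIV. x - y $ j) =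
        (\<Prod>i\<in>UNIV. x - q $ i) * (1 - b * (\<Sum>i\<in>UNIV. 1 / (x - q $ i)))"
      by (simp only: of_real_eq_iff)
    \<comment> \<open>The 1 is rewritten by the equation for \<open>y $ a\<close>, which makes the
      factor \<open>x - y $ a\<close> appear.\<close>
    also have "1 - b * (\<Sum>i\<in>UNIV. 1 / (x - q $ i)) =
        b * (\<Sum>i\<in>UNIV. 1 / (y $ a - q $ i) - 1 / (x - q $ i))"
      using b by (simp add: sum_subtractf sum right_diff_distrib)
    also have "(\<Sum>i\<in>UNIV. 1 / (y $ a - q $ i) - 1 / (x - q $ i)) =
        (x - y $ a) * (\<Sum>i\<in>UNIV. 1 / ((y $ a - q $ i) * (x - q $ i)))"
      unfolding sum_distrib_left
    proof (intro sum.cong refl)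
      fix i
      have "y $ a - q $ i \<noteq> 0" "x - q $ i \<noteq> 0" using x ne[of a i] by auto
      then show "1 / (y $ a - q $ i) - 1 / (x - q $ i) =
          (x - y $ a) * (1 / ((y $ a - q $ i) * (x - q $ i)))"
        by (simp add: diff_frac_eq)
    qed
    also have "(\<Prod>j\<in>UNIV. x - y $ j) = (x - y $ a) * L x"
      unfolding L_def by (rule prod.remove) auto
    finally have "(x - y $ a) * L x = (x - y $ a) * M x"
      by (simp add: M_def mult_ac)
    then show ?thesis using x by simp
  qed
  \<comment> \<open>\<open>LM\<close> excludes the point \<open>y $ a\<close> itself; equality there
    is recovered by continuity.\<close>
  have "eventually (\<lambda>x. x \<noteq> y $ a \<and> (\<forall>i. x \<noteq> q $ i)) (at (y $ a))"
    by (rule eventually_conj[OF eventually_neq_at_within eventually_all_finite])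
      (rule eventually_neq_at_within)
  then have ev: "eventually (\<lambda>x. L x = M x) (at (y $ a))"
    by (rule eventually_mono) (use LM in auto)
  have "L \<midarrow>y $ a\<rightarrow> L (y $ a)"
    unfolding L_def by (intro tendsto_intros)
  moreover have "M \<midarrow>y $ a\<rightarrow> M (y $ a)"
    unfolding M_def using ne by (intro tendsto_intros) auto
  ultimately have "L (y $ a) = M (y $ a)"
    using tendsto_cong[OF ev] by (blast intro: LIM_unique)
  moreover have "L (y $ a) = 0"
    unfolding L_def using aa by (intro prod_zero) auto
  moreover have "(\<Sum>i\<in>(UNIV :: 'n set). 1 / ((y $ a - q $ i) * (y $ a - q $ i))) > 0"
    by (intro sum_pos) (use ne in \<open>auto simp flip: power2_eq_square\<close>)
  ultimately show False
    using b ne by (simp add: M_def)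
qed

text \<open>The roots of \<open>Q - b Q'\<close> are the eigenvalues of the rank-one perturbation
  \<open>diag(q) + b J\<close>, \<open>J\<close> the all-ones matrix, and the eigenvector for the root \<open>y\<^sub>j\<close> is
  \<open>(1 / (y\<^sub>j - q\<^sub>i))\<^sub>i\<close>.\<close>

lemma linear_op_eigenbasis:
  fixes q :: "real ^ 'n"
  assumes inj: "inj (\<lambda>i. q $ i)" and b: "b \<noteq> 0"
  obtains y :: "real ^ 'n" and U :: "real ^ 'n ^ 'n" where
    "zeros_poly q - smult (of_real b) (pderiv (zeros_poly q)) = zeros_poly y"
    "orthogonal_matrix U"
    "\<And>i j. y $ j * U $ j $ i = q $ i * U $ j $ i + b * (\<Sum>k\<in>UNIV. U $ j $ k)"
proof -
  obtain y :: "real ^ 'n" where y: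
    "zeros_poly q - smult (of_real b) (pderiv (zeros_poly q)) = zeros_poly y"
    "\<And>i j. y $ j \<noteq> q $ i" "\<And>j. (\<Sum>i\<in>UNIV. 1 / (y $ j - q $ i)) = 1 / b"
    using linear_op_hyperbolic[OF assms] by blast
  have inj_y: "inj (\<lambda>j. y $ j)" by (rule linear_op_simple[OF y b])
  \<comment> \<open>Squared length of the unnormalised eigenvector; row \<open>j\<close> of
    \<open>U\<close> is the unit eigenvector for \<open>y $ j\<close>.\<close>
  define N where "N j = (\<Sum>i\<in>UNIV. 1 / (y $ j - q $ i)\<^sup>2)" for j
  have N: "N j > 0" for j
    unfolding N_def by (intro sum_pos) (use y(2) in auto)
  define U :: "real ^ 'n ^ 'n" where "U = (\<chi> j i. 1 / (sqrt (N j) * (y $ j - q $ i)))"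
  have "(\<Sum>i\<in>UNIV. U $ j $ i * U $ k $ i) = (if j = k then 1 else 0)" for j k
  proof (cases "j = k")
    case True
    have "(\<Sum>i\<in>UNIV. U $ j $ i * U $ j $ i) = (\<Sum>i\<in>UNIV. (1 / N j) * (1 / (y $ j - q $ i)\<^sup>2))"
      using N[of j] by (intro sum.cong) (auto simp: U_def power2_eq_square mult_ac)
    also have "\<dots> = 1" using N[of j] unfolding sum_distrib_left[symmetric] by (simp flip: N_def)
    finally show ?thesis using True by simp
  next
    case False
    \<comment> \<open>Partial fractions reduce the inner product to a difference of two sums that
      both equal 1/b.\<close>
    then have ne: "y $ k - y $ j \<noteq> 0" using inj_y by (auto simp: inj_on_def)
    have "(\<Sum>i\<in>UNIV. U $ j $ i * U $ k $ i) =
      (\<Sum>i\<in>UNIV. (1 / (sqrt (N j) * sqrt (N k) * (y $ k - y $ j))) *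
        (1 / (y $ j - q $ i) - 1 / (y $ k - q $ i)))"
    proof (intro sum.cong refl)
      fix i
      have "1 / (y $ j - q $ i) - 1 / (y $ k - q $ i) =
          (y $ k - y $ j) / ((y $ j - q $ i) * (y $ k - q $ i))"
        using y(2)[of j i] y(2)[of k i] by (simp add: field_simps)
      then show "U $ j $ i * U $ k $ i = (1 / (sqrt (N j) * sqrt (N k) * (y $ k - y $ j))) *
        (1 / (y $ j - q $ i) - 1 / (y $ k - q $ i))"
        using ne by (simp add: U_def mult_ac)
    qed
    also have "\<dots> = 0" unfolding sum_distrib_left[symmetric] sum_subtractf y(3) by simp
    finally show ?thesis using False by simp
  qed
  then have "U ** transpose U = mat 1"
    by (simp add: vec_eq_iff matrix_matrix_mult_def transpose_def mat_def)
  then have "orthogonal_matrix U"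
    unfolding orthogonal_matrix by (simp add: matrix_left_right_inverse)
  moreover have "y $ j * U $ j $ i = q $ i * U $ j $ i + b * (\<Sum>k\<in>UNIV. U $ j $ k)" for i j
  proof -
    have "(\<Sum>k\<in>UNIV. U $ j $ k) = (\<Sum>k\<in>UNIV. (1 / sqrt (N j)) * (1 / (y $ j - q $ k)))"
      by (simp add: U_def)
    also have "\<dots> = 1 / (sqrt (N j) * b)"
      unfolding sum_distrib_left[symmetric] y(3) by simp
    finally have sum: "(\<Sum>k\<in>UNIV. U $ j $ k) = 1 / (sqrt (N j) * b)" .
    have "U $ j $ i = 1 / (sqrt (N j) * (y $ j - q $ i))" by (simp add: U_def)
    then show ?thesis
      unfolding sum using N[of j] b y(2)[of j i] by (simp add: divide_simps) (simp add: algebra_simps)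
  qed
  ultimately show ?thesis using that y(1) by blast
qed

section \<open>Doubly stochastic averages from orthogonal matrices\<close>

lemma orthogonal_matrix_rows:
  fixes U :: "real ^ 'n ^ 'n"
  assumes "orthogonal_matrix U"
  shows "(\<Sum>i\<in>UNIV. U $ j $ i * U $ k $ i) = (if j = k then 1 else 0)"
    and "(\<Sum>i\<in>UNIV. U $ i $ j * U $ i $ k) = (if j = k then 1 else 0)"
  using assms
  by (auto simp: orthogonal_matrix_def vec_eq_iff matrix_matrix_mult_def transpose_def mat_def)

text \<open>Squared entries of an orthogonal matrix are doubly stochastic: unit row sums allow
  Jensen's inequality in each row, and unit column sums collapse the total. It applies to diagonal
  entries of a symmetric matrix as averages of eigenvalues.\<close>

lemma orthostochastic_convex_le:
  fixes U :: "real ^ 'n ^ 'n" and X Y :: "real ^ 'n"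
  assumes U: "orthogonal_matrix U" and f: "convex_on UNIV f"
    and X: "\<And>k. X $ k = (\<Sum>j\<in>UNIV. (U $ k $ j)\<^sup>2 * Y $ j)"
  shows "(\<Sum>k\<in>UNIV. f (X $ k)) \<le> (\<Sum>j\<in>UNIV. f (Y $ j))"
proof -
  note rows = orthogonal_matrix_rows[OF U, unfolded power2_eq_square[symmetric]]
  have "f (X $ k) \<le> (\<Sum>j\<in>UNIV. (U $ k $ j)\<^sup>2 * f (Y $ j))" for k
    unfolding X using rows(1)[of k k]
      convex_on_sum[OF _ _ f, of UNIV "\<lambda>j. (U $ k $ j)\<^sup>2" "\<lambda>j. Y $ j"]
    by (simp add: power2_eq_square)
  then have "(\<Sum>k\<in>UNIV. f (X $ k)) \<le> (\<Sum>k\<in>UNIV. \<Sum>j\<in>UNIV. (U $ k $ j)\<^sup>2 * f (Y $ j))"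
    by (intro sum_mono)
  also have "\<dots> = (\<Sum>j\<in>UNIV. (\<Sum>k\<in>UNIV. (U $ k $ j)\<^sup>2) * f (Y $ j))"
    unfolding sum_distrib_right by (rule sum.swap)
  also have "\<dots> = (\<Sum>j\<in>UNIV. f (Y $ j))"
    using rows(2) by (simp add: power2_eq_square)
  finally show ?thesis .
qed

section \<open>Majorization for the factors of the product\<close>

definition pf_factor :: "real \<Rightarrow> complex fps" where
  "pf_factor b = (1 - fps_const (of_real b) * fps_X) * fps_exp (of_real b)"

text \<open>Dilation only rescales the parameter, so comparing dilates of a factor means comparing
  two parameters.\<close>

lemma dilate_pf_factor: "dilate t (pf_factor b) = pf_factor (t * b)"
proof -
  have "dilate t (1 - fps_const (of_real b) * fps_X) = 1 - fps_const (of_real (t * b)) * fps_X"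
    by (rule fps_ext) (auto simp: fps_X_def)
  moreover have "dilate t (fps_exp (of_real b)) = fps_exp (of_real (t * b))"
    by (rule fps_ext) (simp add: power_mult_distrib)
  ultimately show ?thesis by (simp add: pf_factor_def dilate_mult)
qed

lemma pf_factor_0 [simp]: "pf_factor 0 = 1"
  by (simp add: pf_factor_def)

text \<open>With the exponential applied last, it translates the zeros of Q - bQ' by -b; this is the
  passage from b J to b (J - I).\<close>

lemma pf_factor_op:
  "fps_op (pf_factor b) P = pcompose (P - smult (of_real b) (pderiv P)) [:of_real b, 1:]"
  unfolding pf_factor_def by (subst mult.commute) (simp add: fps_op_mult fps_op_exp fps_op_linear)

lemma pcompose_zeros_poly:
  "pcompose (zeros_poly X) [:of_real b, 1:] = zeros_poly (\<chi> i. X $ i - b)"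
  by (simp add: zeros_poly_def pcompose_prod pcompose_pCons)

text \<open>Put A(r) = diag(q) + r b (J - I) = (1-r) diag(q) + r A(1). In an eigenbasis of A(r), its
  eigenvalues are (1-r) p_k + r w_k, where p_k and w_k are the diagonal entries of diag(q) and A(1).
  Convexity separates the two; \<open>p\<close> averages \<open>q\<close>, \<open>w\<close> averages
  \<open>Y\<close>, and \<open>q\<close> is itself majorized by \<open>Y\<close>.\<close>

lemma pf_factor_majorization_simple:
  fixes q :: "real ^ 'n"
  assumes inj: "inj (\<lambda>i. q $ i)" and r: "0 \<le> r" "r \<le> 1"
  obtains X Y :: "real ^ 'n" where
    "fps_op (pf_factor (r * b)) (zeros_poly q) = zeros_poly X"
    "fps_op (pf_factor b) (zeros_poly q) = zeros_poly Y" "majorized X Y"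
proof (cases "b = 0")
  case True
  then show ?thesis by (intro that[of q q]) (auto simp: majorized_def)
next
  case False
  obtain y U where y: "zeros_poly q - smult (of_real b) (pderiv (zeros_poly q)) = zeros_poly y"
    and U: "orthogonal_matrix U"
    and yU: "\<And>i j. y $ j * U $ j $ i = q $ i * U $ j $ i + b * (\<Sum>k\<in>UNIV. U $ j $ k)"
    using linear_op_eigenbasis[OF inj False] by metis
  define Y where "Y = (\<chi> j. y $ j - b)"
  have Y: "fps_op (pf_factor b) (zeros_poly q) = zeros_poly Y"
    by (simp add: pf_factor_op y pcompose_zeros_poly Y_def)
  note U_orth = orthogonal_matrix_rows[OF U]
  text \<open>In the eigenbasis \<open>U\<close>, the diagonal entries of \<open>diag(q) + b (J - I)\<close> are the \<open>q\<^sub>i\<close>.\<close>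
  have qY: "q $ i = (\<Sum>j\<in>UNIV. (transpose U $ i $ j)\<^sup>2 * Y $ j)" for i
  proof -
    have "(\<Sum>j\<in>UNIV. (transpose U $ i $ j)\<^sup>2 * Y $ j) =
      (\<Sum>j\<in>UNIV. U $ j $ i * (y $ j * U $ j $ i) - b * (U $ j $ i * U $ j $ i))"
      by (intro sum.cong) (simp_all add: transpose_def Y_def power2_eq_square algebra_simps)
    also have "\<dots> = (\<Sum>j\<in>UNIV. q $ i * (U $ j $ i * U $ j $ i)
        + b * (\<Sum>k\<in>UNIV. U $ j $ i * U $ j $ k) - b * (U $ j $ i * U $ j $ i))"
      unfolding yU by (intro sum.cong) (simp_all add: sum_distrib_left algebra_simps)
    also have "\<dots> = q $ i * (\<Sum>j\<in>UNIV. U $ j $ i * U $ j $ i)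
        + b * (\<Sum>k\<in>UNIV. \<Sum>j\<in>UNIV. U $ j $ i * U $ j $ k) - b * (\<Sum>j\<in>UNIV. U $ j $ i * U $ j $ i)"
      unfolding sum.swap[of "\<lambda>k j. U $ j $ i * U $ j $ k"]
      by (simp only: sum_subtractf sum.distrib sum_distrib_left[symmetric])
    also have "\<dots> = q $ i" by (simp add: U_orth)
    finally show ?thesis by simp
  qed
  have UT: "orthogonal_matrix (transpose U)" using U by (simp add: orthogonal_matrix_def)
  have qY_maj: "majorized q Y"
    unfolding majorized_def using orthostochastic_convex_le[OF UT _ qY] by blast
  \<comment> \<open>\<open>linear_op_eigenbasis\<close> needs a nonzero parameter
    \<open>r * b\<close>, so \<open>r = 0\<close> is split off.\<close>
  show ?thesis
  proof (cases "r = 0")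
    case True
    then show ?thesis using Y qY_maj by (intro that[of q Y]) auto
  next
    case r0: False
    obtain x V where x: "zeros_poly q - smult (of_real (r * b)) (pderiv (zeros_poly q)) = zeros_poly x"
      and V: "orthogonal_matrix V"
      and xV: "\<And>i j. x $ j * V $ j $ i = q $ i * V $ j $ i + r * b * (\<Sum>k\<in>UNIV. V $ j $ k)"
      using linear_op_eigenbasis[OF inj, of "r * b"] False r0 by (metis mult_eq_0_iff)
    define X where "X = (\<chi> j. x $ j - r * b)"
    have X: "fps_op (pf_factor (r * b)) (zeros_poly q) = zeros_poly X"
      by (simp only: pf_factor_op x pcompose_zeros_poly X_def)
    note V_orth = orthogonal_matrix_rows[OF V]
    \<comment> \<open>Change of basis between the eigenvectors of A(1), the rows of
      \<open>U\<close>, and those of A(r), the rows of \<open>V\<close>.\<close>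
    define W where "W = V ** transpose U"
    have W: "orthogonal_matrix W" unfolding W_def by (rule orthogonal_matrix_mul[OF V UT])
    note W_orth = orthogonal_matrix_rows[OF W]
    have W_nth: "W $ k $ j = (\<Sum>i\<in>UNIV. V $ k $ i * U $ j $ i)" for k j
      by (simp add: W_def matrix_matrix_mult_def transpose_def)
    have "W ** U = V"
      using U by (simp add: W_def orthogonal_matrix_def flip: matrix_mul_assoc)
    then have WU: "(\<Sum>j\<in>UNIV. W $ k $ j * U $ j $ i) = V $ k $ i" for k i
      by (auto simp: matrix_matrix_mult_def)
    define p where "p = (\<chi> k. \<Sum>i\<in>UNIV. (V $ k $ i)\<^sup>2 * q $ i)"
    define w where "w = (\<chi> k. \<Sum>j\<in>UNIV. (W $ k $ j)\<^sup>2 * Y $ j)"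
    define S where "S k = (\<Sum>i\<in>UNIV. V $ k $ i)" for k
    \<comment> \<open>Rayleigh quotient of the unit eigenvector \<open>V $ k\<close>; the all-ones
      matrix contributes the square of its entry sum.\<close>
    have x_eq: "x $ k = p $ k + r * b * (S k)\<^sup>2" for k
    proof -
      have "x $ k = (\<Sum>i\<in>UNIV. V $ k $ i * (x $ k * V $ k $ i))"
        using V_orth(1)[of k k] by (simp add: mult.left_commute flip: sum_distrib_left)
      also have "\<dots> = (\<Sum>i\<in>UNIV. (V $ k $ i)\<^sup>2 * q $ i + (r * b * S k) * V $ k $ i)"
        unfolding xV S_def[symmetric]
        by (intro sum.cong) (simp_all add: power2_eq_square algebra_simps)
      also have "\<dots> = p $ k + r * b * (S k)\<^sup>2"
        unfolding sum.distrib sum_distrib_left[symmetric]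
        by (simp add: p_def S_def power2_eq_square)
      finally show ?thesis .
    qed
    \<comment> \<open>The same quadratic form for parameter \<open>b\<close>, expanded in the
      eigenbasis \<open>U\<close>; writing one \<open>W\<close> through \<open>V\<close> and
      \<open>U\<close> lets the eigenvalue equation \<open>yU\<close> be inserted.\<close>
    have w_eq: "w $ k = p $ k + b * (S k)\<^sup>2 - b" for k
    proof -
      have "w $ k = (\<Sum>j\<in>UNIV. W $ k $ j * (W $ k $ j * y $ j) - b * (W $ k $ j * W $ k $ j))"
        unfolding w_def Y_def
        by (simp add: power2_eq_square algebra_simps)
      also have "\<dots> = (\<Sum>j\<in>UNIV. W $ k $ j * (W $ k $ j * y $ j)) - b"
        using W_orth(1)[of k k] by (simp add: sum_subtractf flip: sum_distrib_left)
      also have "(\<Sum>j\<in>UNIV. W $ k $ j * (W $ k $ j * y $ j)) =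
        (\<Sum>j\<in>UNIV. \<Sum>i\<in>UNIV. W $ k $ j * (V $ k $ i * (y $ j * U $ j $ i)))"
        by (subst (2) W_nth) (simp add: sum_distrib_left sum_distrib_right mult_ac)
      also have "\<dots> = (\<Sum>j\<in>UNIV. \<Sum>i\<in>UNIV. V $ k $ i * q $ i * (W $ k $ j * U $ j $ i)
          + b * V $ k $ i * (\<Sum>l\<in>UNIV. W $ k $ j * U $ j $ l))"
        unfolding yU by (intro sum.cong refl) (simp add: sum_distrib_left algebra_simps)
      also have "\<dots> = (\<Sum>i\<in>UNIV. V $ k $ i * q $ i * (\<Sum>j\<in>UNIV. W $ k $ j * U $ j $ i)
          + b * V $ k $ i * (\<Sum>l\<in>UNIV. \<Sum>j\<in>UNIV. W $ k $ j * U $ j $ l))"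
        unfolding sum.swap[of "\<lambda>l j. W $ k $ j * U $ j $ l"]
        by (subst sum.swap) (simp only: sum.distrib sum_distrib_left)
      also have "\<dots> = (\<Sum>i\<in>UNIV. (V $ k $ i)\<^sup>2 * q $ i + b * S k * V $ k $ i)"
        unfolding WU S_def[symmetric]
        by (intro sum.cong) (simp_all add: power2_eq_square algebra_simps)
      also have "\<dots> = p $ k + b * (S k)\<^sup>2"
        unfolding sum.distrib sum_distrib_left[symmetric]
        by (simp add: p_def S_def power2_eq_square)
      finally show ?thesis .
    qed
    have X_eq: "X $ k = (1 - r) *\<^sub>R p $ k + r *\<^sub>R w $ k" for k
      by (simp add: X_def x_eq w_eq algebra_simps)
    have "(\<Sum>k\<in>UNIV. f (X $ k)) \<le> (\<Sum>k\<in>UNIV. f (Y $ k))" if f: "convex_on UNIV f" for f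
    proof -
      have "(\<Sum>k\<in>UNIV. f (X $ k)) \<le> (\<Sum>k\<in>UNIV. (1 - r) * f (p $ k) + r * f (w $ k))"
        unfolding X_eq using r by (intro sum_mono convex_onD[OF f]) auto
      also have "\<dots> = (1 - r) * (\<Sum>k\<in>UNIV. f (p $ k)) + r * (\<Sum>k\<in>UNIV. f (w $ k))"
        by (simp add: sum.distrib sum_distrib_left)
      also have "\<dots> \<le> (1 - r) * (\<Sum>k\<in>UNIV. f (Y $ k)) + r * (\<Sum>k\<in>UNIV. f (Y $ k))"
      proof (intro add_mono mult_left_mono)
        have "(\<Sum>k\<in>UNIV. f (p $ k)) \<le> (\<Sum>k\<in>UNIV. f (q $ k))"
          by (rule orthostochastic_convex_le[OF V f]) (simp add: p_def)
        also have "\<dots> \<le> (\<Sum>k\<in>UNIV. f (Y $ k))"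
          using qY_maj f by (simp add: majorized_def)
        finally show "(\<Sum>k\<in>UNIV. f (p $ k)) \<le> (\<Sum>k\<in>UNIV. f (Y $ k))" .
        show "(\<Sum>k\<in>UNIV. f (w $ k)) \<le> (\<Sum>k\<in>UNIV. f (Y $ k))"
          by (rule orthostochastic_convex_le[OF W f]) (simp add: w_def)
      qed (use r in auto)
      finally show ?thesis by (simp add: algebra_simps)
    qed
    then show ?thesis using X Y by (intro that[of X Y]) (auto simp: majorized_def)
  qed
qed

text \<open>Equal coordinates are separated by distinct multiples of 1/(m+1), unequal ones by
  convergence; dropping an initial segment gives injectivity for every \<open>m\<close>.\<close>

lemma perturb_distinct:
  fixes q :: "real ^ 'n"
  obtains X :: "nat \<Rightarrow> real ^ 'n" where "\<And>m. inj (\<lambda>i. X m $ i)" "X \<longlonglongrightarrow> q"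
proof -
  obtain h :: "'n \<Rightarrow> nat" where h: "inj h"
    using finite_imp_inj_to_nat_seg[of "UNIV :: 'n set"] by auto
  define Z where "Z m = (\<chi> i. q $ i + real (h i) * inverse (real (Suc m)))" for m
  have lim: "(\<lambda>m. Z m $ i) \<longlonglongrightarrow> q $ i" for i
  proof -
    have "(\<lambda>m. q $ i + real (h i) * inverse (real (Suc m))) \<longlonglongrightarrow> q $ i + real (h i) * 0"
      by (intro tendsto_intros LIMSEQ_inverse_real_of_nat)
    then show ?thesis by (simp add: Z_def)
  qed
  have "eventually (\<lambda>m. Z m $ i \<noteq> Z m $ j) sequentially" if "i \<noteq> j" for i j
  proof (cases "q $ i = q $ j")
    case True
    then show ?thesis using h that by (simp add: Z_def inj_eq)
  next
    case False
    have "(\<lambda>m. Z m $ i - Z m $ j) \<longlonglongrightarrow> q $ i - q $ j"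
      by (intro tendsto_diff lim)
    from tendsto_imp_eventually_ne[OF this, of 0] False show ?thesis by simp
  qed
  then have "eventually (\<lambda>m. \<forall>i j. i \<noteq> j \<longrightarrow> Z m $ i \<noteq> Z m $ j) sequentially"
    by (intro eventually_all_finite) (auto simp: eventually_mono)
  then obtain N where N: "\<And>m i j. m \<ge> N \<Longrightarrow> i \<noteq> j \<Longrightarrow> Z m $ i \<noteq> Z m $ j"
    by (auto simp: eventually_sequentially)
  show ?thesis
  proof (rule that[of "\<lambda>m. Z (m + N)"])
    show "inj (\<lambda>i. Z (m + N) $ i)" for m
      using N[of "m + N"] by (auto simp: inj_on_def)
    show "(\<lambda>m. Z (m + N)) \<longlonglongrightarrow> q"
      by (intro LIMSEQ_ignore_initial_segment vec_tendstoI lim)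
  qed
qed

section \<open>Closure of the majorization property under products and limits\<close>

text \<open>Hyperbolicity is included so that a second operator can act on the result, and constant
  term 1 keeps polynomials monic. The factor \<open>r\<close> encodes the pair (s, t) as (r t,
  t).\<close>

definition majorization_monotone :: "nat \<Rightarrow> complex fps \<Rightarrow> bool" where
  "majorization_monotone n F \<longleftrightarrow> fps_nth F 0 = 1 \<and>
     (\<forall>P\<in>hyperbolic_polys n. \<forall>t. fps_op (dilate t F) P \<in> hyperbolic_polys n \<and>
        (\<forall>r f. 0 \<le> r \<longrightarrow> r \<le> 1 \<longrightarrow> convex_on UNIV f \<longrightarrow>
           zero_sum f (fps_op (dilate (r * t) F) P) \<le> zero_sum f (fps_op (dilate t F) P)))"

lemma majorization_monotone_1: "majorization_monotone n 1"
proof -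
  have "dilate t 1 = 1" for t by (rule fps_ext) simp
  then show ?thesis by (simp add: majorization_monotone_def)
qed

text \<open>The operators commute, so the dilation can be undone on one factor at a time.\<close>

lemma majorization_monotone_mult:
  assumes "majorization_monotone n F" "majorization_monotone n G"
  shows "majorization_monotone n (F * G)"
  unfolding majorization_monotone_def
proof (intro conjI ballI allI impI)
  show "fps_nth (F * G) 0 = 1" using assms by (simp add: majorization_monotone_def)
  fix P t assume P: "P \<in> hyperbolic_polys n"
  show "fps_op (dilate t (F * G)) P \<in> hyperbolic_polys n"
    using assms P by (simp add: majorization_monotone_def dilate_mult fps_op_mult)
  fix r :: real and f :: "real \<Rightarrow> real"
  assume r: "0 \<le> r" "r \<le> 1" and f: "convex_on UNIV f"
  have comm: "fps_op (dilate a F) (fps_op (dilate b G) P) =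
      fps_op (dilate b G) (fps_op (dilate a F) P)" for a b
    unfolding fps_op_mult[symmetric] by (simp add: mult.commute)
  have "zero_sum f (fps_op (dilate (r * t) F) (fps_op (dilate (r * t) G) P)) \<le>
      zero_sum f (fps_op (dilate t F) (fps_op (dilate (r * t) G) P))"
    using assms P r f by (simp add: majorization_monotone_def)
  also have "\<dots> \<le> zero_sum f (fps_op (dilate t F) (fps_op (dilate t G) P))"
    unfolding comm using assms P r f by (simp add: majorization_monotone_def)
  finally show "zero_sum f (fps_op (dilate (r * t) (F * G)) P) \<le> zero_sum f (fps_op (dilate t (F * G)) P)"
    by (simp add: dilate_mult fps_op_mult)
qed

lemma majorization_monotone_prod:
  "(\<And>i. i \<in> A \<Longrightarrow> majorization_monotone n (F i)) \<Longrightarrow> majorization_monotone n (\<Prod>i\<in>A. F i)"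
  by (induction A rule: infinite_finite_induct)
    (auto simp: majorization_monotone_1 intro: majorization_monotone_mult)

lemma majorization_monotone_power:
  "majorization_monotone n F \<Longrightarrow> majorization_monotone n (F ^ k)"
  by (induction k) (auto simp: majorization_monotone_1 intro: majorization_monotone_mult)

text \<open>On a fixed polynomial only finitely many coefficients of the series act, so
  coefficientwise convergence carries over to the images and \<open>hyperbolic_lim\<close>
  applies.\<close>

lemma majorization_monotone_lim:
  assumes F: "\<And>m. majorization_monotone CARD('n::finite) (F m)"
    and lim: "\<And>k. (\<lambda>m. fps_nth (F m) k) \<longlonglongrightarrow> fps_nth G k"
  shows "majorization_monotone CARD('n) G"
proof -
  have "fps_nth G 0 = 1"
    using F lim[of 0] by (simp add: majorization_monotone_def LIMSEQ_const_iff)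
  moreover have *: "fps_op (dilate t G) P \<in> hyperbolic_polys CARD('n) \<and>
      (\<forall>f. convex_on UNIV f \<longrightarrow> zero_sum f (fps_op (dilate (r * t) G) P) \<le> zero_sum f (fps_op (dilate t G) P))"
    if P: "P \<in> hyperbolic_polys CARD('n)" and r: "0 \<le> r" "r \<le> 1" for P t r
  proof -
    have op: "coeffs_lim (\<lambda>m. fps_op (dilate a (F m)) P) (fps_op (dilate a G) P)" for a
      by (rule coeffs_lim_fps_op[of _ _ _ _ "degree P"])
        (auto intro!: tendsto_intros lim simp: coeffs_lim_def)
    have "fps_op (dilate a (F m)) P \<in> hyperbolic_polys CARD('n)" for a m
      using F P unfolding majorization_monotone_def by blast
    then have "\<exists>X :: real ^ 'n. fps_op (dilate a (F m)) P = zeros_poly X" for a m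
      by (metis hyperbolic_zeros_poly)
    then obtain X :: "real \<Rightarrow> nat \<Rightarrow> real ^ 'n"
      where X: "\<And>a m. fps_op (dilate a (F m)) P = zeros_poly (X a m)" by metis
    have "zero_sum f (zeros_poly (X (r * t) m)) \<le> zero_sum f (zeros_poly (X t m))"
      if "convex_on UNIV f" for f m
      unfolding X[symmetric] using F P r that unfolding majorization_monotone_def by blast
    then show ?thesis
      using hyperbolic_lim[OF op[of "r * t", unfolded X] op[of t, unfolded X]] by blast
  qed
  \<comment> \<open>The hyperbolicity clause does not involve \<open>r\<close>; the instance
    \<open>r = 1\<close> supplies it.\<close>
  ultimately show ?thesis
    unfolding majorization_monotone_def using *[of _ 1] by auto
qed

text \<open>Zeros are perturbed to distinct ones, where the eigenbasis argument works, and the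
  perturbation is removed by \<open>hyperbolic_lim\<close>.\<close>

lemma majorization_monotone_pf_factor: "majorization_monotone CARD('n::finite) (pf_factor b)"
proof -
  have *: "fps_op (pf_factor c) P \<in> hyperbolic_polys CARD('n) \<and>
      (\<forall>f. convex_on UNIV f \<longrightarrow> zero_sum f (fps_op (pf_factor (r * c)) P) \<le> zero_sum f (fps_op (pf_factor c) P))"
    if P: "P \<in> hyperbolic_polys CARD('n)" and r: "0 \<le> r" "r \<le> 1" for P c r
  proof -
    obtain q :: "real ^ 'n" where q: "P = zeros_poly q" using P by (rule hyperbolic_zeros_poly)
    obtain Q where Q: "\<And>m. inj (\<lambda>i. Q m $ i)" "Q \<longlonglongrightarrow> q"
      by (rule perturb_distinct[of q]) blast
    have "\<exists>X Y :: real ^ 'n. fps_op (pf_factor (r * c)) (zeros_poly (Q m)) = zeros_poly X \<and>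
        fps_op (pf_factor c) (zeros_poly (Q m)) = zeros_poly Y \<and> majorized X Y" for m
      using pf_factor_majorization_simple[OF Q(1) r] by metis
    then obtain X Y :: "nat \<Rightarrow> real ^ 'n" where
      X: "\<And>m. fps_op (pf_factor (r * c)) (zeros_poly (Q m)) = zeros_poly (X m)" and
      Y: "\<And>m. fps_op (pf_factor c) (zeros_poly (Q m)) = zeros_poly (Y m)" and
      maj: "\<And>m. majorized (X m) (Y m)" by metis
    have op: "coeffs_lim (\<lambda>m. fps_op (pf_factor a) (zeros_poly (Q m))) (fps_op (pf_factor a) P)" for a
      unfolding q
      by (rule coeffs_lim_fps_op[of _ _ _ _ "CARD('n)"]) (auto intro: coeffs_lim_zeros_poly Q)
    show ?thesis
      using hyperbolic_lim[OF op[of "r * c", unfolded X] op[of c, unfolded Y]] maj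
      unfolding majorized_def zero_sum_zeros_poly by blast
  qed
  have "fps_nth (pf_factor b) 0 = 1" by (simp add: pf_factor_def)
  then show ?thesis
    unfolding majorization_monotone_def dilate_pf_factor
    using *[of _ 1] by (auto simp: mult.assoc *)
qed

section \<open>The Laguerre-Polya class\<close>

text \<open>Weierstrass: uniform limits of holomorphic functions are holomorphic, and derivatives at
  0, hence Taylor coefficients, converge.\<close>

lemma fps_expansion_uniform_limit:
  assumes lim: "uniform_limit (ball 0 1) f g sequentially"
    and hol: "\<And>m. f m holomorphic_on ball 0 1" and fps: "\<And>m. f m has_fps_expansion F m"
  shows "(\<lambda>m. fps_nth (F m) k) \<longlonglongrightarrow> fps_nth (fps_expansion g 0) k"
    and "g has_fps_expansion fps_expansion g 0"
proof -
  have "(\<lambda>m. (deriv ^^ k) (f m) 0 / fact k) \<longlonglongrightarrow> (deriv ^^ k) g 0 / fact k"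
    by (intro tendsto_divide tendsto_const higher_deriv_complex_uniform_limit[OF lim])
      (auto simp: hol)
  then show "(\<lambda>m. fps_nth (F m) k) \<longlonglongrightarrow> fps_nth (fps_expansion g 0) k"
    by (simp add: fps_nth_fps_expansion[OF fps] fps_expansion_def)
  have "g holomorphic_on ball 0 1"
  proof (rule holomorphic_uniform_sequence[of _ f])
    fix z :: complex assume "z \<in> ball 0 1"
    then show "\<exists>d>0. cball z d \<subseteq> ball 0 1 \<and> uniform_limit (cball z d) f g sequentially"
      by (metis lim open_ball open_contains_cball uniform_limit_on_subset)
  qed (use hol in auto)
  then show "g has_fps_expansion fps_expansion g 0"
    by (rule has_fps_expansion_fps_expansion[of "ball 0 1", rotated 2]) auto
qed

lemma has_fps_expansion_pf_factor:
  "(\<lambda>z. (1 - of_real b * z) * exp (of_real b * z)) has_fps_expansion pf_factor b"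
  unfolding pf_factor_def by (intro fps_expansion_intros)

text \<open>With v = u/N, the N-th powers of 1 + v and exp v differ by at most N times their
  second-order difference, once both are scaled into the unit disc.\<close>

lemma exp_limit_bound:
  fixes u :: complex
  assumes "norm u \<le> M" "N > 0"
  shows "norm ((1 + u / of_nat N) ^ N - exp u) \<le> exp (2 * M) * M\<^sup>2 / N"
proof -
  define d where "d = M / N"
  \<comment> \<open>Common bound for the norms of 1 + v and exp v, chosen so that K^N = exp
    M.\<close>
  define K where "K = exp d"
  have M: "M \<ge> 0" using assms norm_ge_zero order_trans by blast
  then have K: "K \<ge> 1" and d: "d \<ge> 0" by (simp_all add: K_def d_def)
  define v where "v = u / of_nat N"
  have v: "norm v \<le> d" using assms by (simp add: v_def d_def norm_divide divide_right_mono)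
  have "norm (exp v - (1 + v)) \<le> exp (norm v) * norm v ^ 2"
    using Taylor_exp_field[of v 1] by (simp add: power2_eq_square)
  also have "\<dots> \<le> K * d\<^sup>2"
    unfolding K_def using v by (intro mult_mono power_mono) auto
  finally have diff: "norm ((1 + v) - exp v) \<le> K * d\<^sup>2" by (simp add: norm_minus_commute)
  have "norm (1 + v) \<le> 1 + norm v" using norm_triangle_ineq[of 1 v] by simp
  also have "\<dots> \<le> exp (norm v)" by (rule exp_ge_add_one_self)
  also have "\<dots> \<le> K" using v by (simp add: K_def)
  finally have le1: "norm ((1 + v) / of_real K) \<le> 1" using K by (simp add: norm_divide)
  have "norm (exp v) \<le> K" using norm_exp[of v] v unfolding K_def by (smt (verit) exp_le_cancel_iff)
  then have le2: "norm (exp v / of_real K) \<le> 1" using K by (simp add: norm_divide)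
  have "norm ((1 + v) ^ N - exp u) = norm ((1 + v) ^ N - exp v ^ N)"
    using assms by (simp add: v_def flip: exp_of_nat_mult)
  also have "\<dots> = K ^ N * norm (((1 + v) / of_real K) ^ N - (exp v / of_real K) ^ N)"
    using K by (simp add: power_divide norm_divide norm_power flip: diff_divide_distrib)
  also have "\<dots> \<le> K ^ N * (N * norm ((1 + v) / of_real K - exp v / of_real K))"
    by (intro mult_left_mono norm_power_diff le1 le2) (use K in auto)
  also have "\<dots> = K ^ N * (N * (norm ((1 + v) - exp v) / K))"
    using K by (simp add: norm_divide flip: diff_divide_distrib)
  also have "\<dots> \<le> K ^ N * (N * d\<^sup>2)"
    using diff K by (intro mult_left_mono) (auto simp: pos_divide_le_eq mult.commute)
  also have "K ^ N = exp M" using assms by (simp add: K_def d_def flip: exp_of_nat_mult)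
  also have "exp M * (N * d\<^sup>2) = exp M * M\<^sup>2 / N"
    using assms by (simp add: d_def power2_eq_square)
  also have "\<dots> \<le> exp (2 * M) * M\<^sup>2 / N"
    using M by (intro divide_right_mono mult_right_mono) auto
  finally show ?thesis by (simp add: v_def)
qed

lemma gaussian_majorization_monotone:
  fixes a :: real
  defines "g \<equiv> \<lambda>z :: complex. exp (- (of_real a)\<^sup>2 * z\<^sup>2)"
  shows "majorization_monotone CARD('n::finite) (fps_expansion g 0)"
    and "g has_fps_expansion fps_expansion g 0"
proof -
  \<comment> \<open>Factors for b and -b are paired: the exponentials cancel and leave 1 - b^2 z^2,
    with b^2 = a^2/(m+1). \<open>Suc m\<close> avoids division by zero.\<close>
  define b where "b m = a / sqrt (Suc m)" for m
  define f where "f m z = (((1 - of_real (b m) * z) * exp (of_real (b m) * z)) *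
      ((1 - of_real (- b m) * z) * exp (of_real (- b m) * z))) ^ Suc m" for m and z :: complex
  have f: "f m z = (1 + (- (of_real a)\<^sup>2 * z\<^sup>2) / of_nat (Suc m)) ^ Suc m" for m z
  proof -
    have "(1 - of_real (b m) * z) * exp (of_real (b m) * z) *
        ((1 - of_real (- b m) * z) * exp (of_real (- b m) * z)) = 1 - of_real ((b m)\<^sup>2) * z\<^sup>2"
      by (simp add: exp_minus field_simps power2_eq_square)
    also have "of_real ((b m)\<^sup>2) = (of_real a)\<^sup>2 / complex_of_nat (Suc m)"
      by (simp add: b_def power_divide)
    finally show ?thesis by (simp add: f_def del: of_nat_Suc)
  qed
  have bound: "dist (f m z) (g z) \<le> exp (2 * a\<^sup>2) * (a\<^sup>2)\<^sup>2 * inverse (Suc m)" if "z \<in> ball 0 1" for m z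
  proof -
    have "norm z \<le> 1" using that by simp
    then have "norm (- (of_real a)\<^sup>2 * z\<^sup>2) \<le> a\<^sup>2"
      by (simp add: norm_mult norm_power mult_left_le power_le_one)
    from exp_limit_bound[OF this, of "Suc m"] show ?thesis
      by (simp add: dist_norm f g_def divide_inverse del: of_nat_Suc power_Suc)
  qed
  have "(\<lambda>m. exp (2 * a\<^sup>2) * (a\<^sup>2)\<^sup>2 * inverse (Suc m)) \<longlonglongrightarrow> exp (2 * a\<^sup>2) * (a\<^sup>2)\<^sup>2 * 0"
    by (intro tendsto_intros LIMSEQ_inverse_real_of_nat)
  then have lim0: "(\<lambda>m. exp (2 * a\<^sup>2) * (a\<^sup>2)\<^sup>2 * inverse (Suc m)) \<longlonglongrightarrow> 0" by simp
  have lim: "uniform_limit (ball 0 1) f g sequentially"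
  proof (rule uniform_limitI)
    fix e :: real assume "e > 0"
    then have "eventually (\<lambda>m. exp (2 * a\<^sup>2) * (a\<^sup>2)\<^sup>2 * inverse (Suc m) < e) sequentially"
      using lim0 by (rule order_tendstoD(2)[rotated])
    then show "\<forall>\<^sub>F m in sequentially. \<forall>z\<in>ball 0 1. dist (f m z) (g z) < e"
      by eventually_elim (use bound in \<open>blast intro: le_less_trans\<close>)
  qed
  have hol: "f m holomorphic_on ball 0 1" for m
    unfolding f_def by (intro holomorphic_intros)
  have fps: "f m has_fps_expansion (pf_factor (b m) * pf_factor (- b m)) ^ Suc m" for m
    unfolding f_def
    by (intro has_fps_expansion_power has_fps_expansion_mult has_fps_expansion_pf_factor)
  note * = fps_expansion_uniform_limit[OF lim hol fps]
  show "g has_fps_expansion fps_expansion g 0" by (rule *)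
  show "majorization_monotone CARD('n) (fps_expansion g 0)"
    by (rule majorization_monotone_lim[OF _ *(1)])
      (intro majorization_monotone_power majorization_monotone_mult majorization_monotone_pf_factor)
qed

text \<open>The factors are Weierstrass factors of genus 1, so they differ from 1 by O((\<alpha>
  k)^2) on the unit disc, and the partial products converge uniformly by the M-test.\<close>

lemma pf_product_majorization_monotone:
  fixes \<alpha> :: "nat \<Rightarrow> real"
  assumes sum: "summable (\<lambda>k. (\<alpha> k)\<^sup>2)"
  defines "g \<equiv> \<lambda>z :: complex. \<Prod>k. (1 - of_real (\<alpha> k) * z) * exp (of_real (\<alpha> k) * z)"
  shows "majorization_monotone CARD('n::finite) (fps_expansion g 0)"
    and "g has_fps_expansion fps_expansion g 0"
proof -
  define h where "h k z = (1 - of_real (\<alpha> k) * z) * exp (of_real (\<alpha> k) * z)" for k and z :: complex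
  define f where "f m z = (\<Prod>k<m. h k z)" for m z
  have "(\<lambda>k. (\<alpha> k)\<^sup>2) \<longlonglongrightarrow> 0" by (rule summable_LIMSEQ_zero[OF sum])
  then have "eventually (\<lambda>k. (\<alpha> k)\<^sup>2 < (1 / 2)\<^sup>2) sequentially"
    by (rule order_tendstoD) simp
  \<comment> \<open>The Weierstrass factor estimate requires arguments of norm at most 1/2, which
    holds on the unit disc for late factors.\<close>
  then have small: "eventually (\<lambda>k. \<bar>\<alpha> k\<bar> \<le> 1 / 2) sequentially"
    by eventually_elim (metis abs_le_square_iff abs_of_nonneg less_eq_real_def zero_le_divide_1_iff zero_le_numeral)
  have bound: "norm (h k z - 1) \<le> 3 * (\<alpha> k)\<^sup>2" if "\<bar>\<alpha> k\<bar> \<le> 1 / 2" "z \<in> cball 0 1" for k z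
  proof -
    have *: "norm (of_real (\<alpha> k) * z) \<le> \<bar>\<alpha> k\<bar>"
      using that by (simp add: norm_mult mult_left_le)
    then have "norm (weierstrass_factor 1 (of_real (\<alpha> k) * z) - 1) \<le> 3 * norm (of_real (\<alpha> k) * z) ^ Suc 1"
      using that by (intro weierstrass_factor_bound) simp
    also have "\<dots> \<le> 3 * \<bar>\<alpha> k\<bar> ^ Suc 1"
      using * by (intro mult_left_mono power_mono) auto
    finally show ?thesis
      by (simp add: weierstrass_factor_def h_def power2_eq_square)
  qed
  have summ: "summable (\<lambda>k. 3 * (\<alpha> k)\<^sup>2)" by (intro summable_mult sum)
  have "uniformly_convergent_on (cball 0 1) (\<lambda>N z. \<Sum>k<N. norm (h k z - 1))"
    by (rule Weierstrass_m_test'_ev[OF _ summ])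
      (use small in \<open>eventually_elim, use bound in auto\<close>)
  then have "uniformly_convergent_on (cball 0 1) f"
    unfolding f_def
    by (intro uniformly_convergent_on_prod') (auto simp: h_def intro!: continuous_intros)
  then obtain l where l: "uniform_limit (cball 0 1) f l sequentially"
    by (auto simp: uniformly_convergent_on_def)
  \<comment> \<open>The M-test yields some uniform limit \<open>l\<close>; it is matched pointwise
    with the infinite product.\<close>
  have "l z = g z" if z: "z \<in> cball 0 1" for z
  proof -
    have "summable (\<lambda>k. norm (h k z - 1))"
      by (rule summable_comparison_test_ev[OF _ summ])
        (use small in \<open>eventually_elim, use bound z in auto\<close>)
    then have "convergent_prod (\<lambda>k. h k z)"
      by (intro abs_convergent_prod_imp_convergent_prod summable_imp_abs_convergent_prod)
    \<comment> \<open>The library limit runs over products up to and including index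
      \<open>m\<close>, hence the shift to \<open>Suc m\<close>.\<close>
    from convergent_prod_LIMSEQ[OF this] have "(\<lambda>m. f (Suc m) z) \<longlonglongrightarrow> g z"
      by (simp add: f_def g_def h_def lessThan_Suc_atMost)
    moreover have "(\<lambda>m. f (Suc m) z) \<longlonglongrightarrow> l z"
      using tendsto_uniform_limitI[OF l z] by (rule LIMSEQ_Suc)
    ultimately show ?thesis using LIMSEQ_unique by blast
  qed
  then have "uniform_limit (cball 0 1) f g sequentially"
    using l by (subst uniform_limit_cong'[of _ f f g l]) auto
  then have lim: "uniform_limit (ball 0 1) f g sequentially"
    by (rule uniform_limit_on_subset) auto
  have hol: "f m holomorphic_on ball 0 1" for m
    unfolding f_def h_def by (intro holomorphic_intros)
  have fps: "f m has_fps_expansion (\<Prod>k<m. pf_factor (\<alpha> k))" for m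
    unfolding f_def h_def by (intro has_fps_expansion_prod has_fps_expansion_pf_factor)
  note * = fps_expansion_uniform_limit[OF lim hol fps]
  show "g has_fps_expansion fps_expansion g 0" by (rule *)
  show "majorization_monotone CARD('n) (fps_expansion g 0)"
    by (rule majorization_monotone_lim[OF _ *(1)])
      (intro majorization_monotone_prod majorization_monotone_pf_factor)
qed

text \<open>The constant is split off because \<open>majorization_monotone\<close> demands constant
  term 1; a nonzero scalar moves no zeros.\<close>

lemma LP0'_fps_expansion:
  assumes "\<phi> \<in> LP0'"
  obtains c F where "c \<noteq> 0" "fps_expansion \<phi> 0 = fps_const c * F"
    "majorization_monotone CARD('n::finite) F"
proof -
  obtain a c :: real and \<alpha> :: "nat \<Rightarrow> real" where c: "c \<noteq> 0" and \<alpha>: "summable (\<lambda>k. (\<alpha> k)\<^sup>2)"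
    and \<phi>: "\<And>z. \<phi> z = of_real c * exp (- (of_real a)\<^sup>2 * z\<^sup>2) *
             (\<Prod>k. (1 - of_real (\<alpha> k) * z) * exp (of_real (\<alpha> k) * z))"
    using assms unfolding LP0'_def by blast
  define g where "g z = exp (- (of_real a)\<^sup>2 * z\<^sup>2)" for z :: complex
  define h where "h z = (\<Prod>k. (1 - of_real (\<alpha> k) * z) * exp (of_real (\<alpha> k) * z))" for z :: complex
  note g = gaussian_majorization_monotone[of a, folded g_def]
  note h = pf_product_majorization_monotone[OF \<alpha>, folded h_def]
  have "(\<lambda>z. of_real c * (g z * h z)) has_fps_expansion
      fps_const (of_real c) * (fps_expansion g 0 * fps_expansion h 0)"
    by (intro has_fps_expansion_mult has_fps_expansion_const g(2) h(2))
  moreover have "\<phi> = (\<lambda>z. of_real c * (g z * h z))"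
    by (simp add: fun_eq_iff \<phi> g_def h_def mult.assoc)
  ultimately have "fps_expansion \<phi> 0 = fps_const (of_real c) * (fps_expansion g 0 * fps_expansion h 0)"
    by (simp add: fps_expansion_eqI)
  then show ?thesis
    using c majorization_monotone_mult[OF g(1) h(1)]
    by (intro that[of "of_real c" "fps_expansion g 0 * fps_expansion h 0"]) auto
qed

theorem corollary10:
  fixes \<phi> :: "complex \<Rightarrow> complex" and s t :: real and P :: "complex poly"
  assumes "\<phi> \<in> LP0'"
    and "\<bar>s\<bar> \<le> \<bar>t\<bar>" and "s * t \<ge> 0"
    and "P \<in> hyperbolic_polys CARD('n::finite)"
  shows "(\<exists>X :: real ^ 'n. is_zero_tuple (diff_op \<phi> s P) X) \<and>
    (\<exists>Y :: real ^ 'n. is_zero_tuple (diff_op \<phi> t P) Y) \<and>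
    (\<forall>X Y Z :: real ^ 'n.
       is_zero_tuple (diff_op \<phi> s P) X \<longrightarrow>
       is_zero_tuple (diff_op \<phi> t P) Y \<longrightarrow>
       is_zero_tuple P Z \<longrightarrow>
       (\<forall>\<Phi> :: real ^ 'n \<Rightarrow> real. schur_convex \<Phi> \<longrightarrow> \<Phi> X \<le> \<Phi> Y) \<and>
       (\<forall>f :: real \<Rightarrow> real. convex_on UNIV f \<longrightarrow>
          (\<Sum>i\<in>UNIV. f (X $ i)) \<le> (\<Sum>i\<in>UNIV. f (Y $ i)) \<and>
          (\<Sum>i\<in>UNIV. f (Z $ i)) \<le> (\<Sum>i\<in>UNIV. f (Y $ i))))"
proof -
  obtain c F where c: "c \<noteq> 0" and \<phi>: "fps_expansion \<phi> 0 = fps_const c * F"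
    and F: "majorization_monotone CARD('n) F"
    using LP0'_fps_expansion[OF assms(1)] by blast
  define Q where "Q u = fps_op (dilate u F) P" for u
  have "dilate u (fps_const c) = fps_const c" for u by (rule fps_ext) simp
  then have diff_op: "diff_op \<phi> u P = smult c (Q u)" for u
    by (simp add: diff_op_dilate \<phi> dilate_mult fps_op_mult Q_def)
  have zero_tuple: "is_zero_tuple (diff_op \<phi> u P) X \<longleftrightarrow> is_zero_tuple (Q u) X" for u and X :: "real ^ 'n"
    using c by (simp add: is_zero_tuple_def diff_op)
  have hyp: "Q u \<in> hyperbolic_polys CARD('n)" for u
    using F assms(4) by (simp add: Q_def majorization_monotone_def)
  have ex: "\<exists>X :: real ^ 'n. is_zero_tuple (diff_op \<phi> u P) X" for u
    using is_zero_tuple_zeros_poly hyperbolic_zeros_poly[OF hyp[of u]] unfolding zero_tuple by metis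
  have mono: "zero_sum f (Q (r * t)) \<le> zero_sum f (Q t)"
    if "0 \<le> r" "r \<le> 1" "convex_on UNIV f" for r f
    using F assms(4) that by (simp add: Q_def majorization_monotone_def)
  \<comment> \<open>The ratio s/t works: the sign condition gives r \<ge> 0 and the bound on
    absolute values gives r \<le> 1. If t = 0, then s = 0 as well.\<close>
  obtain r where r: "0 \<le> r" "r \<le> 1" "s = r * t"
  proof (cases "t = 0")
    case True
    then show ?thesis using assms(2) by (intro that[of 0]) auto
  next
    case False
    show ?thesis
    proof (rule that[of "s / t"])
      show "0 \<le> s / t" using assms(3) by (auto simp: zero_le_divide_iff zero_le_mult_iff)
      then have "s / t = \<bar>s\<bar> / \<bar>t\<bar>" by (simp flip: abs_divide)
      then show "s / t \<le> 1" using assms(2) False by simp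
    qed (use False in simp)
  qed
  \<comment> \<open>Only the constant term, which is 1, survives dilation by 0; so the comparison
    with \<open>P\<close> itself is the case \<open>r = 0\<close> of \<open>mono\<close>.\<close>
  have "dilate 0 F = 1"
    using F by (intro fps_ext) (simp add: majorization_monotone_def power_0_left)
  then have Q0: "Q 0 = P" by (simp add: Q_def)
  show ?thesis
  proof (intro conjI allI impI ex)
    fix X Y Z :: "real ^ 'n"
    assume "is_zero_tuple (diff_op \<phi> s P) X" "is_zero_tuple (diff_op \<phi> t P) Y" and Z: "is_zero_tuple P Z"
    then have X: "is_zero_tuple (Q s) X" and Y: "is_zero_tuple (Q t) Y"
      by (simp_all add: zero_tuple)
    have XY: "(\<Sum>i\<in>UNIV. f (X $ i)) \<le> (\<Sum>i\<in>UNIV. f (Y $ i))" if "convex_on UNIV f" for f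
      using mono[OF r(1,2) that] zero_sum_zero_tuple[OF X, of f] zero_sum_zero_tuple[OF Y, of f] r(3)
      by simp
    then show "(\<Sum>i\<in>UNIV. f (X $ i)) \<le> (\<Sum>i\<in>UNIV. f (Y $ i))" if "convex_on UNIV f" for f
      using that .
    have "majorized X Y" unfolding majorized_def using XY by blast
    then show "\<Phi> X \<le> \<Phi> Y" if "schur_convex \<Phi>" for \<Phi>
      using that unfolding schur_convex_def by blast
    show "(\<Sum>i\<in>UNIV. f (Z $ i)) \<le> (\<Sum>i\<in>UNIV. f (Y $ i))" if "convex_on UNIV f" for f
      using mono[of 0, OF _ _ that] zero_sum_zero_tuple[OF Z, of f] zero_sum_zero_tuple[OF Y, of f]
      by (simp add: Q0)
  qed
qed

end
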